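(* Let $\ell\ge 1$ and $g\geq 3\ell-1$ be integers. Then $$n(g, g-\ell)=|\mathcal{V}(\ell)|,$$ where $n(g,g-\ell)$ is the number of numerical semigroups of genus $g$ and type $g-\ell$, and $\mathcal{V}(\ell)$ is the set of stable gap vectors in $\mathbb{Z}^{2\ell}$ (which is defined independently of $g$). In particular $n(g,g-\ell)$ depends only on $\ell$ once $g\ge 3\ell-1$.
   Context: A numerical semigroup $\Lambda$ is a subset of $\mathbb{N}_0$ containing $0$, closed under addition, with finite complement in $\mathbb{N}_0$. The elements of $Gaps(\Lambda)=\mathbb{N}_0\setminus\Lambda$ are its gaps, and the genus $g(\Lambda)$ is the number of gaps. The set of pseudo-Frobenius numbers is $PF(\Lambda)=\{x\in\mathbb{Z}\setminus\Lambda : x+\lambda\in\Lambda \text{ for all } \lambda\in\Lambda\setminus\{0\}\}$ and the type is $t(\Lambda)=|PF(\Lambda)|$. If $\Lambda$ has genus $g>0$ and type $g-\ell$ with $\ell\ge 1$, then $\{1,\dots,g-\ell\}\subseteq Gaps(\Lambda)\subseteq\{1,\dots,g+\ell\}$. The gap vector of $\Lambda$ is the $(0/1)$-vector $v(\Lambda)=(v_1,\dots,v_{2\ell})$ with $v_i=1$ if $g-\ell+i\in Gaps(\Lambda)$ and $v_i=0$ otherwise. A vector $v\in\mathbb{Z}^{2\ell}$ is called a stable gap vector if, for some integer $g\ge 3\ell-1$, there exists a numerical semigroup $\Lambda$ of genus $g$ and type $g-\ell$ with $v=v(\Lambda)$. The set of stable gap vectors in $\mathbb{Z}^{2\ell}$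 is denoted $\mathcal{V}(\ell)$. *)

theory Defs
  imports Main
begin

definition numerical_semigroup :: "nat set \<Rightarrow> bool" where
  "numerical_semigroup L \<longleftrightarrow>
     0 \<in> L \<and> (\<forall>a\<in>L. \<forall>b\<in>L. a + b \<in> L) \<and> finite (UNIV - L)"

definition gaps :: "nat set \<Rightarrow> nat set" where
  "gaps L = UNIV - L"

definition genus :: "nat set \<Rightarrow> nat" where
  "genus L = card (gaps L)"

definition pseudo_frobenius :: "nat set \<Rightarrow> int set" where
  "pseudo_frobenius L =
     {x. x \<notin> int ` L \<and> (\<forall>s\<in>L - {0}. x + int s \<in> int ` L)}"

definition sg_type :: "nat set \<Rightarrow> nat" where
  "sg_type L = card (pseudo_frobenius L)"

definition num_semigroups :: "nat \<Rightarrow> nat \<Rightarrow> nat" where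
  "num_semigroups g t = card {L. numerical_semigroup L \<and> genus L = g \<and> sg_type L = t}"

text \<open>Vectors in \<open>\<int>\<^sup>n\<close> are integer lists of length \<open>n\<close>. The parameter \<open>l\<close> is recovered from
  the semigroup as genus minus type; the list entry at (zero-based) position \<open>i - 1\<close> is the
  component \<open>v\<^sub>i\<close>.\<close>

definition gap_vector :: "nat set \<Rightarrow> int list" where
  "gap_vector L =
     (let g = genus L; l = g - sg_type L
      in map (\<lambda>i. if g - l + i \<in> gaps L then 1 else 0) [1..<2 * l + 1])"

text \<open>Only \<open>l \<ge> 1\<close> is meant; then \<open>3 * l - 1 \<ge> 2\<close> and \<open>g - l \<ge> 1\<close>, so that the subtractions
  on natural numbers are exact and \<open>g\<close> may be taken to be a natural number.\<close>

definition stable_gap_vector :: "nat \<Rightarrow> int list \<Rightarrow> bool" where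
  "stable_gap_vector l v \<longleftrightarrow>
     length v = 2 * l \<and>
     (\<exists>g \<ge> 3 * l - 1. \<exists>L. numerical_semigroup L \<and> genus L = g \<and> sg_type L = g - l \<and>
        v = gap_vector L)"

definition stable_gap_vectors :: "nat \<Rightarrow> int list set" where
  "stable_gap_vectors l = {v. stable_gap_vector l v}"

text \<open>The sets being counted are finite, so \<^const>\<open>card\<close> is the actual number of elements.\<close>

lemma gaps_less_twice_genus:
  assumes "numerical_semigroup L" and "x \<in> gaps L"
  shows "x < 2 * genus L"
proof -
  have fin: "finite (gaps L)"
    using assms(1) by (simp add: numerical_semigroup_def gaps_def)
  have "{..x} \<subseteq> gaps L \<union> (\<lambda>a. x - a) ` gaps L"
  proof
    fix a assume "a \<in> {..x}"
    then have a: "a + (x - a) = x" "a = x - (x - a)" by auto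
    have "a \<in> gaps L \<or> x - a \<in> gaps L"
    proof (rule ccontr)
      assume "\<not> ?thesis"
      then have "a + (x - a) \<in> L"
        using assms(1) by (auto simp: numerical_semigroup_def gaps_def)
      then show False using assms(2) a(1) by (simp add: gaps_def)
    qed
    then show "a \<in> gaps L \<union> (\<lambda>a. x - a) ` gaps L" using a(2) by blast
  qed
  then have "card {..x} \<le> card (gaps L \<union> (\<lambda>a. x - a) ` gaps L)"
    using fin by (intro card_mono) auto
  also have "\<dots> \<le> card (gaps L) + card ((\<lambda>a. x - a) ` gaps L)"
    by (rule card_Un_le)
  also have "\<dots> \<le> 2 * genus L"
    using card_image_le[OF fin, of "\<lambda>a. x - a"] by (simp add: genus_def)
  finally show ?thesis by simp
qed

lemma finite_semigroups_of_genus_type: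
  "finite {L. numerical_semigroup L \<and> genus L = g \<and> sg_type L = t}"
proof (rule finite_subset)
  show "{L. numerical_semigroup L \<and> genus L = g \<and> sg_type L = t} \<subseteq> uminus ` Pow {..<2 * g}"
  proof
    fix L assume "L \<in> {L. numerical_semigroup L \<and> genus L = g \<and> sg_type L = t}"
    then have "- L \<subseteq> {..<2 * g}"
      using gaps_less_twice_genus[of L] by (auto simp: gaps_def)
    then show "L \<in> uminus ` Pow {..<2 * g}"
      by (intro image_eqI[of _ _ "- L"]) auto
  qed
qed simp

lemma finite_stable_gap_vectors: "finite (stable_gap_vectors l)"
proof (rule finite_subset)
  show "stable_gap_vectors l \<subseteq> {v. set v \<subseteq> {0, 1} \<and> length v = 2 * l}"
    by (auto simp: stable_gap_vectors_def stable_gap_vector_def gap_vector_def Let_def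
        split: if_splits)
qed (simp add: finite_lists_length_eq)

lemma finite_pseudo_frobenius:
  assumes "numerical_semigroup L"
  shows "finite (pseudo_frobenius L)"
proof -
  have fin: "finite (gaps L)"
    using assms by (simp add: numerical_semigroup_def gaps_def)
  then have "infinite L"
    using finite_Un[of "gaps L" L] by (auto simp: gaps_def)
  then have "\<exists>s. s \<in> L - {0}"
    by (metis finite.emptyI finite_Diff_insert Diff_empty ex_in_conv)
  then obtain s where s: "s \<in> L - {0}" by blast
  have "pseudo_frobenius L \<subseteq> {- int s..<0} \<union> int ` gaps L"
  proof
    fix x assume x: "x \<in> pseudo_frobenius L"
    then have "x + int s \<ge> 0" using s by (force simp: pseudo_frobenius_def)
    moreover have "x \<in> int ` gaps L" if "x \<ge> 0"
      using that x by (cases x rule: int_cases) (auto simp: pseudo_frobenius_def gaps_def)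
    ultimately show "x \<in> {- int s..<0} \<union> int ` gaps L"
      by (cases "x \<ge> 0") auto
  qed
  then show ?thesis using fin by (meson finite_UnI finite_atLeastLessThan_int finite_imageI finite_subset)
qed

end

(* Every gap that is not pseudo-Frobenius is a difference "gap minus nonzero element", and type
   g - l means that there are exactly l of them. Pseudo-Frobenius gaps are pairwise incongruent and
   nonzero modulo any nonzero element, so all nonzero elements exceed g - l; reflecting the
   nonzero elements below a gap f through f gives non-pseudo-Frobenius gaps, so f is at most g + l.
   For g >= 3l - 1 the sum of two nonzero elements then exceeds g + l, so closure under addition is
   automatic and the semigroup is an arbitrary l-subset A of the window {1..2l}, shifted by g - l.
   The non-pseudo-Frobenius gaps are at most 2l - 1 <= g - l and are exactly the positive
   differences a - b with a in A and b in the window outside A, a condition free of g. *)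

theory Submission
  imports Defs
begin

section \<open>Non-pseudo-Frobenius gaps and the bounds they impose\<close>

definition non_pf_gaps :: "nat set \<Rightarrow> nat set" where
  "non_pf_gaps L = {x \<in> gaps L. \<exists>s\<in>L - {0}. x + s \<in> gaps L}"

lemma numerical_semigroup_mult:
  assumes "numerical_semigroup L" and "s \<in> L"
  shows "k * s \<in> L"
  by (induction k) (use assms in \<open>auto simp: numerical_semigroup_def\<close>)

text \<open>Positive genus matters: -1 is pseudo-Frobenius for the semigroup of all naturals. With
  \<open>m\<close> the least nonzero element, a negative \<open>x\<close> has
  \<open>x + m < m\<close>, which forces \<open>x = - m\<close>; then the element
  \<open>f + m\<close> is sent to the largest gap \<open>f\<close>.\<close>

lemma pseudo_frobenius_nonneg:
  assumes g: "genus L > 0" and x: "x \<in> pseudo_frobenius L"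
  shows "x \<ge> 0"
proof (rule ccontr)
  assume neg: "\<not> x \<ge> 0"
  have fin: "finite (gaps L)" and ne: "gaps L \<noteq> {}"
    using g by (auto simp: genus_def card_gt_0_iff)
  define f where "f = Max (gaps L)"
  have f: "f \<in> gaps L" unfolding f_def by (rule Max_in[OF fin ne])
  have above: "y \<in> L" if "y > f" for y
    using Max_ge[OF fin, of y] that by (auto simp: f_def gaps_def)
  define m where "m = (LEAST s. s \<in> L \<and> s \<noteq> 0)"
  have "m \<in> L \<and> m \<noteq> 0" unfolding m_def
    by (rule LeastI[of _ "Suc f"]) (simp add: above)
  then have m: "m \<in> L" "m > 0" by auto
  have le: "m \<le> s" if "s \<in> L" "s \<noteq> 0" for s
    unfolding m_def by (rule Least_le) (use that in simp)
  obtain y where y: "y \<in> L" "x + int m = int y"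
    using x m by (auto simp: pseudo_frobenius_def)
  have "y = 0" using le[of y] y neg by linarith
  then have "x = - int m" using y by simp
  moreover have "f + m \<in> L - {0}" using above[of "f + m"] m by simp
  then have "x + int (f + m) \<in> int ` L" using x unfolding pseudo_frobenius_def by blast
  ultimately show False using f by (auto simp: gaps_def)
qed

lemma pseudo_frobenius_eq:
  assumes g: "genus L > 0"
  shows "pseudo_frobenius L = int ` (gaps L - non_pf_gaps L)"
proof (intro set_eqI iffI)
  fix x assume x: "x \<in> pseudo_frobenius L"
  then obtain n where n: "x = int n"
    using pseudo_frobenius_nonneg[OF g] nonneg_int_cases by blast
  have "n + s \<in> L" if "s \<in> L - {0}" for s
  proof -
    have "int (n + s) \<in> int ` L" using x that by (auto simp: pseudo_frobenius_def n)
    then show ?thesis by (simp only: inj_image_mem_iff inj_of_nat)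
  qed
  moreover have "n \<notin> L" using x by (auto simp: pseudo_frobenius_def n)
  ultimately have "n \<in> gaps L - non_pf_gaps L" by (auto simp: non_pf_gaps_def gaps_def)
  then show "x \<in> int ` (gaps L - non_pf_gaps L)" unfolding n by (rule imageI)
next
  fix x assume "x \<in> int ` (gaps L - non_pf_gaps L)"
  then obtain n where n: "x = int n" "n \<in> gaps L" "n \<notin> non_pf_gaps L" by blast
  have "int n + int s \<in> int ` L" if "s \<in> L - {0}" for s
  proof -
    have "n + s \<in> L" using n that by (auto simp: non_pf_gaps_def gaps_def)
    then show ?thesis by (metis imageI of_nat_add)
  qed
  then show "x \<in> pseudo_frobenius L" using n by (auto simp: pseudo_frobenius_def gaps_def)
qed

lemma sg_type_eq:
  assumes "genus L > 0"
  shows "sg_type L = card (gaps L - non_pf_gaps L)"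
  using pseudo_frobenius_eq[OF assms] by (simp add: sg_type_def card_image)

lemma genus_eq_type_plus:
  assumes g: "genus L > 0"
  shows "genus L = sg_type L + card (non_pf_gaps L)"
proof -
  have "finite (gaps L)" using g by (auto simp: genus_def card_gt_0_iff)
  moreover have "non_pf_gaps L \<subseteq> gaps L" by (auto simp: non_pf_gaps_def)
  ultimately show ?thesis unfolding sg_type_eq[OF assms]
    by (simp add: genus_def card_Diff_subset card_mono finite_subset)
qed

text \<open>Distinct gaps congruent modulo \<open>s\<close> differ by a positive multiple of
  \<open>s\<close>, so the smaller is not pseudo-Frobenius. Multiples of \<open>s\<close> are not
  gaps, which leaves \<open>s - 1\<close> residues.\<close>

lemma sg_type_less_element:
  assumes L: "numerical_semigroup L" and g: "genus L > 0" and s: "s \<in> L" "s > 0"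
  shows "sg_type L < s"
proof -
  let ?P = "gaps L - non_pf_gaps L"
  have shift: "y + k * s \<in> L" if "y \<in> ?P" "k > 0" for y k
    using that numerical_semigroup_mult[OF L s(1), of k] s(2)
    by (auto simp: non_pf_gaps_def gaps_def)
  have neq: False if "x \<in> ?P" "y \<in> ?P" "x mod s = y mod s" "y < x" for x y
  proof -
    have "s dvd x - y" using that by (simp add: mod_eq_dvd_iff_nat)
    then obtain k where "x - y = s * k" ..
    then have k: "x = y + k * s" using that(4) by (simp add: mult.commute)
    then have "k > 0" using that by (cases k) auto
    then show False using shift[OF that(2)] that(1) k by (auto simp: gaps_def)
  qed
  have "inj_on (\<lambda>x. x mod s) ?P"
    by (rule inj_onI) (metis neq linorder_neqE_nat)
  moreover have "(\<lambda>x. x mod s) ` ?P \<subseteq> {1..<s}"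
  proof
    fix r assume "r \<in> (\<lambda>x. x mod s) ` ?P"
    then obtain x where x: "x \<in> ?P" "r = x mod s" by blast
    have "r \<noteq> 0"
    proof
      assume "r = 0"
      then have "x = (x div s) * s" using x by auto
      then have "x \<in> L" by (metis numerical_semigroup_mult[OF L s(1)])
      then show False using x by (simp add: gaps_def)
    qed
    then show "r \<in> {1..<s}" using x s by simp
  qed
  ultimately have "card ?P \<le> card {1..<s}" by (intro card_inj_on_le) auto
  then show ?thesis using sg_type_eq[OF g] s by simp
qed

text \<open>Split \<open>{1..f}\<close> into gaps and elements. The map sending \<open>s\<close> to
  \<open>f - s\<close> embeds the elements into the non-pseudo-Frobenius gaps, since adding
  \<open>s\<close> back returns the gap \<open>f\<close>.\<close>

lemma gap_le:
  assumes L: "numerical_semigroup L" and f: "f \<in> gaps L"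
  shows "f \<le> genus L + card (non_pf_gaps L)"
proof -
  have fin: "finite (gaps L)" using L by (simp add: numerical_semigroup_def gaps_def)
  then have finN: "finite (non_pf_gaps L)" by (simp add: non_pf_gaps_def)
  let ?S = "L \<inter> {1..f}"
  have "f - s \<in> non_pf_gaps L" if "s \<in> ?S" for s
  proof -
    have "(f - s) + s = f" using that by simp
    moreover from this have "f - s \<notin> L"
      using that f L by (metis IntE DiffE gaps_def numerical_semigroup_def)
    ultimately show ?thesis using that f unfolding non_pf_gaps_def gaps_def by force
  qed
  moreover have "inj_on (\<lambda>s. f - s) ?S" by (rule inj_onI) auto
  ultimately have 1: "card ?S \<le> card (non_pf_gaps L)"
    using finN by (intro card_inj_on_le) auto
  have "{1..f} \<subseteq> gaps L \<union> ?S" by (auto simp: gaps_def)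
  then have "card {1..f} \<le> card (gaps L \<union> ?S)" using fin by (intro card_mono) auto
  also have "\<dots> \<le> genus L + card ?S" unfolding genus_def by (rule card_Un_le)
  finally show ?thesis using 1 by simp
qed

section \<open>Windows and the semigroups they define\<close>

definition window_diffs :: "nat \<Rightarrow> nat set \<Rightarrow> nat set" where
  "window_diffs l A = {d. d > 0 \<and> (\<exists>b\<in>{1..2 * l} - A. b + d \<in> A)}"

text \<open>For \<open>l >= 1\<close> and \<open>2 * l <= n + 1\<close>, the first cardinality makes
  the genus of \<open>window_semigroup n A\<close> equal to \<open>n + l\<close>, and the second
  then makes its type \<open>n\<close>.\<close>

definition stable_windows :: "nat \<Rightarrow> nat set set" where
  "stable_windows l = {A. A \<subseteq> {1..2 * l} \<and> card A = l \<and> card (window_diffs l A) = l}"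

text \<open>Given by its complement because \<open>A\<close> records gaps: for \<open>A\<close>
  inside \<open>{1..2 * l}\<close>, the nonzero elements are the \<open>n + b\<close> with
  \<open>b > 0\<close> outside \<open>A\<close>.\<close>

definition window_semigroup :: "nat \<Rightarrow> nat set \<Rightarrow> nat set" where
  "window_semigroup n A = - ({1..n} \<union> (+) n ` A)"

definition window_vector :: "nat \<Rightarrow> nat set \<Rightarrow> int list" where
  "window_vector l A = map (\<lambda>i. if i \<in> A then 1 else 0) [1..<2 * l + 1]"

lemma inj_on_window_vector: "inj_on (window_vector l) (Pow {1..2 * l})"
proof (rule inj_onI)
  fix A B assume AB: "A \<in> Pow {1..2 * l}" "B \<in> Pow {1..2 * l}"
    and eq: "window_vector l A = window_vector l B"
  have "i \<in> A \<longleftrightarrow> i \<in> B" if "i \<in> {1..2 * l}" for i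
  proof -
    have "i \<in> set [1..<2 * l + 1]" using that by auto
    then have "(if i \<in> A then 1 else 0 :: int) = (if i \<in> B then 1 else 0)"
      using eq unfolding window_vector_def map_eq_conv by blast
    then show ?thesis by (simp split: if_splits)
  qed
  then show "A = B" using AB by blast
qed

lemma gaps_window_semigroup: "gaps (window_semigroup n A) = {1..n} \<union> (+) n ` A"
  by (auto simp: gaps_def window_semigroup_def)

lemma mem_gaps_window_semigroup:
  assumes "i > 0"
  shows "n + i \<in> gaps (window_semigroup n A) \<longleftrightarrow> i \<in> A"
  using assms by (auto simp: gaps_window_semigroup)

lemma genus_window_semigroup:
  assumes "A \<subseteq> {1..2 * l}"
  shows "genus (window_semigroup n A) = n + card A"
proof -
  have "finite A" using assms finite_subset by blast
  then have "card ({1..n} \<union> (+) n ` A) = card {1..n} + card ((+) n ` A)"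
    using assms by (intro card_Un_disjoint) auto
  then show ?thesis by (simp add: genus_def gaps_window_semigroup card_image)
qed

text \<open>For \<open>n = g - l\<close> with \<open>l <= g\<close>, the bound on \<open>n\<close>
  is exactly \<open>g >= 3 * l - 1\<close>.\<close>

lemma numerical_semigroup_window:
  assumes A: "A \<subseteq> {1..2 * l}" and n: "2 * l \<le> n + 1"
  shows "numerical_semigroup (window_semigroup n A)"
  unfolding numerical_semigroup_def
proof (intro conjI ballI)
  show "0 \<in> window_semigroup n A" using A by (auto simp: window_semigroup_def)
  show "finite (UNIV - window_semigroup n A)"
    using gaps_window_semigroup[of n A] finite_subset[OF A] by (simp add: gaps_def)
  fix a b assume ab: "a \<in> window_semigroup n A" "b \<in> window_semigroup n A"
  show "a + b \<in> window_semigroup n A"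
  proof (cases "a = 0 \<or> b = 0")
    case False
    then have "a > n" "b > n" using ab by (auto simp: window_semigroup_def not_le)
    \<comment> \<open>Both summands are at least \<open>n + 1\<close>, and \<open>2 * n + 2\<close>
      lies past the last possible gap \<open>n + 2 * l\<close>.\<close>
    then have "a + b > n + 2 * l" using n by simp
    then show ?thesis using A by (auto simp: window_semigroup_def)
  qed (use ab in auto)
qed

text \<open>Adding a nonzero element \<open>n + b\<close> to \<open>x > 0\<close> gives
  \<open>n + (b + x)\<close>, a gap iff \<open>b + x\<close> is in \<open>A\<close>, so the shift
  cancels. Conversely, a difference must itself be shown to be a gap; this uses the bound on
  \<open>n\<close>.\<close>

lemma non_pf_gaps_window_semigroup:
  assumes A: "A \<subseteq> {1..2 * l}" and n: "2 * l \<le> n + 1"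
  shows "non_pf_gaps (window_semigroup n A) = window_diffs l A"
proof (intro set_eqI iffI)
  fix x assume "x \<in> non_pf_gaps (window_semigroup n A)"
  then obtain s where x: "x \<in> gaps (window_semigroup n A)"
    and s: "s \<in> window_semigroup n A" "s \<noteq> 0" and xs: "x + s \<in> gaps (window_semigroup n A)"
    by (auto simp: non_pf_gaps_def)
  have x0: "x > 0" using x A by (auto simp: gaps_window_semigroup)
  have "s > n" using s by (auto simp: window_semigroup_def not_le)
  then obtain b where b: "s = n + b" "b > 0" using less_imp_add_positive by blast
  have "b + x \<in> A"
    using xs x0 mem_gaps_window_semigroup[of "b + x" n A] b by (simp add: ac_simps)
  moreover have "b \<notin> A" using s b by (auto simp: window_semigroup_def)
  moreover have "b \<in> {1..2 * l}" using \<open>b + x \<in> A\<close> A b by auto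
  ultimately show "x \<in> window_diffs l A" using x0 by (auto simp: window_diffs_def)
next
  fix d assume "d \<in> window_diffs l A"
  then obtain b where b: "d > 0" "b \<in> {1..2 * l}" "b \<notin> A" "b + d \<in> A"
    by (auto simp: window_diffs_def)
  then have "b + d \<le> 2 * l" using A by auto
  \<comment> \<open>Here \<open>b >= 1\<close>, so \<open>d <= 2 * l - 1\<close>, which lies in the
    initial run \<open>{1..n}\<close> of gaps.\<close>
  then have "d \<le> n" using n b by auto
  then have "d \<in> gaps (window_semigroup n A)" using b by (simp add: gaps_window_semigroup)
  moreover have "n + b \<in> window_semigroup n A - {0}"
    using mem_gaps_window_semigroup[of b n A] b by (auto simp: gaps_def)
  moreover have "d + (n + b) \<in> gaps (window_semigroup n A)"
    using mem_gaps_window_semigroup[of "b + d" n A] b by (simp add: ac_simps)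
  ultimately show "d \<in> non_pf_gaps (window_semigroup n A)" unfolding non_pf_gaps_def by blast
qed

text \<open>Additive form avoids truncated subtraction. The bounds give \<open>n >= 1\<close>, hence
  positive genus.\<close>

lemma sg_type_window_semigroup:
  assumes l: "l \<ge> 1" and n: "2 * l \<le> n + 1" and A: "A \<subseteq> {1..2 * l}"
  shows "n + card A = sg_type (window_semigroup n A) + card (window_diffs l A)"
  using genus_eq_type_plus[of "window_semigroup n A"] l n
  by (simp add: genus_window_semigroup[OF A] non_pf_gaps_window_semigroup[OF A n])

section \<open>Reading the window off a semigroup\<close>

lemma semigroup_eq_window_semigroup:
  assumes L: "numerical_semigroup L" and g: "genus L = n + l" and t: "sg_type L = n"
    and l: "l \<ge> 1"
  obtains A where "A \<subseteq> {1..2 * l}" and "L = window_semigroup n A"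
proof -
  have g0: "genus L > 0" using g l by simp
  have c: "card (non_pf_gaps L) = l" using genus_eq_type_plus[OF g0] g t by simp
  define A where "A = {i \<in> {1..2 * l}. n + i \<in> gaps L}"
  \<comment> \<open>Genus \<open>n + l\<close> plus the \<open>l\<close> non-pseudo-Frobenius gaps
    gives the right end of the window.\<close>
  have up: "x \<le> n + 2 * l" if "x \<in> gaps L" for x
    using gap_le[OF L that] c g by simp
  have "gaps L = {1..n} \<union> (+) n ` A"
  proof (intro set_eqI iffI)
    fix x assume x: "x \<in> gaps L"
    then have "x > 0" using L by (cases x) (auto simp: gaps_def numerical_semigroup_def)
    show "x \<in> {1..n} \<union> (+) n ` A"
    proof (cases "x \<le> n")
      case False
      then have "x = n + (x - n)" "x - n \<in> A" using x up[OF x] by (auto simp: A_def)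
      then show ?thesis by blast
    qed (use \<open>x > 0\<close> in auto)
  next
    fix x assume "x \<in> {1..n} \<union> (+) n ` A"
    \<comment> \<open>For \<open>x\<close> in \<open>{1..n}\<close>: a nonzero element would exceed
      the type \<open>n\<close>.\<close>
    then show "x \<in> gaps L"
      using sg_type_less_element[OF L g0, of x] t by (fastforce simp: A_def gaps_def)
  qed
  then have "L = window_semigroup n A" by (auto simp: window_semigroup_def gaps_def)
  moreover have "A \<subseteq> {1..2 * l}" by (auto simp: A_def)
  ultimately show ?thesis using that by blast
qed

text \<open>Cancelling \<open>g - l\<close> in the genus and type equations of the window semigroup
  leaves the two cardinality conditions on \<open>A\<close>; the same equations serve both
  directions.\<close>

lemma semigroups_eq_image_windows:
  assumes l: "l \<ge> 1" and g: "g \<ge> 3 * l - 1"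
  shows "{L. numerical_semigroup L \<and> genus L = g \<and> sg_type L = g - l} =
    window_semigroup (g - l) ` stable_windows l"
proof -
  have n: "2 * l \<le> (g - l) + 1" and gn: "(g - l) + l = g" using l g by auto
  show ?thesis
  proof (intro set_eqI iffI)
    fix L assume "L \<in> {L. numerical_semigroup L \<and> genus L = g \<and> sg_type L = g - l}"
    then have L: "numerical_semigroup L" "genus L = (g - l) + l" "sg_type L = g - l"
      by (simp_all add: gn)
    obtain A where A: "A \<subseteq> {1..2 * l}" "L = window_semigroup (g - l) A"
      using semigroup_eq_window_semigroup[OF L l] .
    then have "A \<in> stable_windows l"
      using sg_type_window_semigroup[OF l n A(1)] genus_window_semigroup[OF A(1), of "g - l"] L
      by (simp add: stable_windows_def)
    then show "L \<in> window_semigroup (g - l) ` stable_windows l" using A by blast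
  next
    fix L assume "L \<in> window_semigroup (g - l) ` stable_windows l"
    then obtain A where A: "A \<subseteq> {1..2 * l}" "card A = l" "card (window_diffs l A) = l"
      and L: "L = window_semigroup (g - l) A" by (auto simp: stable_windows_def)
    then show "L \<in> {L. numerical_semigroup L \<and> genus L = g \<and> sg_type L = g - l}"
      using sg_type_window_semigroup[OF l n A(1)] genus_window_semigroup[OF A(1), of "g - l"]
        numerical_semigroup_window[OF A(1) n] gn by simp
  qed
qed

text \<open>The right-hand side is free of \<open>g\<close>, which yields the independence of the
  count from \<open>g\<close>.\<close>

lemma num_semigroups_eq_card_windows:
  assumes "l \<ge> 1" and "g \<ge> 3 * l - 1"
  shows "num_semigroups g (g - l) = card (stable_windows l)"
proof -
  have "inj_on (window_semigroup (g - l)) (stable_windows l)"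
  proof (rule inj_onI)
    fix A B assume AB: "A \<in> stable_windows l" "B \<in> stable_windows l"
      and eq: "window_semigroup (g - l) A = window_semigroup (g - l) B"
    have "i \<in> A \<longleftrightarrow> i \<in> B" if "i \<in> {1..2 * l}" for i
      using mem_gaps_window_semigroup[of i "g - l"] that eq
      by (metis atLeastAtMost_iff less_eq_Suc_le One_nat_def)
    then show "A = B" using AB by (auto simp: stable_windows_def)
  qed
  then show ?thesis
    by (simp add: num_semigroups_def semigroups_eq_image_windows[OF assms] card_image)
qed

section \<open>Gap vectors as indicator vectors of windows, and the count\<close>

lemma gap_vector_window_semigroup:
  assumes l: "l \<ge> 1" and g: "g \<ge> 3 * l - 1" and A: "A \<in> stable_windows l"
  shows "gap_vector (window_semigroup (g - l) A) = window_vector l A"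
proof -
  let ?L = "window_semigroup (g - l) A"
  have L: "genus ?L = g" "sg_type ?L = g - l"
    using semigroups_eq_image_windows[OF l g] A by blast+
  \<comment> \<open>\<open>gap_vector\<close> recovers its half-length as genus minus type; this is
    \<open>l\<close> because \<open>l <= g\<close>.\<close>
  have "g - (g - l) = l" using l g by simp
  then show ?thesis
    unfolding gap_vector_def Let_def L window_vector_def
    by (intro map_cong) (auto simp only: mem_gaps_window_semigroup set_upt atLeastLessThan_iff
      less_eq_Suc_le One_nat_def)
qed

text \<open>The existential over \<open>g\<close> collapses: every admissible genus yields the same
  windows, and the vector depends on the window alone.\<close>

lemma stable_gap_vectors_eq:
  assumes l: "l \<ge> 1"
  shows "stable_gap_vectors l = window_vector l ` stable_windows l"
proof (intro set_eqI iffI)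
  fix v assume "v \<in> stable_gap_vectors l"
  then obtain g L where g: "g \<ge> 3 * l - 1" and v: "v = gap_vector L"
    and "L \<in> {L. numerical_semigroup L \<and> genus L = g \<and> sg_type L = g - l}"
    by (auto simp: stable_gap_vectors_def stable_gap_vector_def)
  then show "v \<in> window_vector l ` stable_windows l"
    unfolding semigroups_eq_image_windows[OF l g]
    using gap_vector_window_semigroup[OF l g] by auto
next
  fix v assume "v \<in> window_vector l ` stable_windows l"
  then obtain A where A: "A \<in> stable_windows l" and v: "v = window_vector l A" by blast
  \<comment> \<open>The least admissible genus serves as the witness.\<close>
  let ?g = "3 * l - 1"
  let ?L = "window_semigroup (?g - l) A"
  have "numerical_semigroup ?L \<and> genus ?L = ?g \<and> sg_type ?L = ?g - l"
    using semigroups_eq_image_windows[OF l order_refl] A by blast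
  moreover have "v = gap_vector ?L" using gap_vector_window_semigroup[OF l order_refl A] v by simp
  moreover have "length v = 2 * l" by (simp add: v window_vector_def)
  ultimately show "v \<in> stable_gap_vectors l"
    unfolding stable_gap_vectors_def stable_gap_vector_def by blast
qed

lemma card_stable_gap_vectors:
  assumes "l \<ge> 1"
  shows "card (stable_gap_vectors l) = card (stable_windows l)"
proof -
  have "inj_on (window_vector l) (stable_windows l)"
    by (rule inj_on_subset[OF inj_on_window_vector]) (auto simp: stable_windows_def)
  then show ?thesis by (simp add: stable_gap_vectors_eq[OF assms] card_image)
qed

theorem theorem3p7:
  fixes l g :: nat
  assumes "l \<ge> 1" and "g \<ge> 3 * l - 1"
  shows "num_semigroups g (g - l) = card (stable_gap_vectors l) \<and>
    (\<forall>g' \<ge> 3 * l - 1. num_semigroups g' (g' - l) = num_semigroups g (g - l))"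
  using assms by (simp add: num_semigroups_eq_card_windows card_stable_gap_vectors)

end
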